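(* Let $F\dashv G:\mathcal{C}\to\mathcal{A}$ be adjoint functors (so $F:\mathcal{A}\to\mathcal{C}$ is left adjoint to $G$) with unit $\eta:1_{\mathcal{A}}\to GF$, and let $\mathcal{S}$ be a co-perfect syntopogenous structure on $\mathcal{C}$ with respect to $\mathcal{M}$. Assume that $G$ and $F$ preserve subobjects. For $X\in\mathcal{A}$ put $$\mathcal{S}^{\eta}_X=\{\sqsubset^{\eta}_X\;|\;\sqsubset_{FX}\in\mathcal{S}_{FX}\},\qquad m\sqsubset^{\eta}_X n\iff\eta_X^{-1}\big(G(U^{\sqsubset}(Fm))\big)\le n\quad(m,n\in\mathrm{sub}X).$$ Then $\mathcal{S}^{\eta}$ is a co-perfect syntopogenous structure on $\mathcal{A}$. It is the coarsest syntopogenous structure on $\mathcal{A}$ for which $F$ is $(\mathcal{S}^{\eta},\mathcal{S})$-continuous.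
   Context: $\mathcal{C}$ is a category with a proper $(\mathcal{E},\mathcal{M})$-factorization system for morphisms ($\mathcal{E}$ consists of epimorphisms, $\mathcal{M}$ of monomorphisms), and it is $\mathcal{M}$-complete: pullbacks of $\mathcal{M}$-morphisms along arbitrary morphisms and arbitrary $\mathcal{M}$-intersections exist and are again in $\mathcal{M}$. Likewise $\mathcal{A}$ is a category with an $(\mathcal{E}',\mathcal{M}')$-factorization system and is $\mathcal{M}'$-complete. For $X\in\mathcal{C}$, $\mathrm{sub}X=\{m\in\mathcal{M}\mid \mathrm{cod}(m)=X\}$, ordered by $n\le m$ iff $m\circ j=n$ for some $j$; isomorphic subobjects are identified, so $\mathrm{sub}X$ is a (possibly large) complete lattice. For $f:X\to Y$, $f(m)$ is the $\mathcal{M}$-component of the factorization of $f\circ m$ and $f^{-1}(n)$ is the pullback of $n$ along $f$. The same conventions apply to $\mathcal{A}$ with $\mathcal{M}'$. $F$ preserves subobjects if $Fm\in\mathcal{M}$ for every $m\in\mathcal{M}'$; $G$ preserves subobjects if $Gn\in\mathcal{M}'$ for every $n\in\mathcal{M}$. The following notions are for $\mathcal{C}$ with $\mathcal{M}$ and likewise for $\mathcal{A}$ with $\mathcal{M}'$. A topogenous order is a family of relations $\sqsubset_X$ on $\mathrm{sub}X$ with (T1) $m\sqsubset_X n\Rightarrow m\le n$; (T2) $m\le n\sqsubset_X p\le q\Rightarrow m\sqsubset_X q$; (T3) for every $f:X\to Y$, $m\sqsubset_Y n\Rightarrow f^{-1}(m)\sqsubset_X f^{-1}(n)$. A relation is $\bigwedge$-preserving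 if ($m\sqsubset_X n_i$ for all $i\in I$) implies $m\sqsubset_X\bigwedge n_i$, and interpolates (is interpolative) if $m\sqsubset_X n$ implies $m\sqsubset_X p\sqsubset_X n$ for some $p$. A syntopogenous structure is a family $\mathcal{S}=\{\mathcal{S}_X\}$ of sets of relations on $\mathrm{sub}X$ such that (S1) each $\sqsubset_X\in\mathcal{S}_X$ satisfies (T1), (T2); (S2) $\mathcal{S}_X$ is directed under inclusion; (S3) the relations $\bigcup\mathcal{S}_X$ form an interpolative topogenous order. It is co-perfect if every $\sqsubset_X\in\mathcal{S}_X$ is $\bigwedge$-preserving. Order: $\mathcal{S}\le\mathcal{S}'$ iff for all $X$ and $\sqsubset_X\in\mathcal{S}_X$ there is $\sqsubset'_X\in\mathcal{S}'_X$ with $\sqsubset_X\subseteq\sqsubset'_X$; "coarsest" means least. For a $\bigwedge$-preserving $\sqsubset_X$, $U^{\sqsubset}(m)=\bigwedge\{n\mid m\sqsubset_X n\}$. For co-perfect syntopogenous structures $\mathcal{T}$ on $\mathcal{A}$ and $\mathcal{S}$ on $\mathcal{C}$, $F$ is $(\mathcal{T},\mathcal{S})$-continuous if for all $X\in\mathcal{A}$ and $\sqsubset'_{FX}\in\mathcal{S}_{FX}$ there is $\sqsubset_X\in\mathcal{T}_X$ such that $F(U^{\sqsubset}(m))\le U^{\sqsubset'}(Fm)$ for all $m\in\mathrm{sub}X$. (This notion is defined only for co-perfect structures, so "coarsest" compares $\mathcal{S}^{\eta}$ with co-perfect structures on $\mathcal{A}$.) *)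

theory Defs
  imports Main
begin

section \<open>Categories, functors, adjunctions\<close>

record ('o, 'a) cat =
  Ob :: "'o set"
  Ar :: "'a set"
  Dom :: "'a \<Rightarrow> 'o"
  Cod :: "'a \<Rightarrow> 'o"
  Id :: "'o \<Rightarrow> 'a"
  Comp :: "'a \<Rightarrow> 'a \<Rightarrow> 'a" (infixl "\<cdot>\<index>" 70)

definition hom :: "('o, 'a) cat \<Rightarrow> 'o \<Rightarrow> 'o \<Rightarrow> 'a set" where
  "hom C X Y = {f \<in> Ar C. Dom C f = X \<and> Cod C f = Y}"

locale category =
  fixes C :: "('o, 'a) cat" (structure)
  assumes Dom_Ob: "f \<in> Ar C \<Longrightarrow> Dom C f \<in> Ob C"
    and Cod_Ob: "f \<in> Ar C \<Longrightarrow> Cod C f \<in> Ob C"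
    and Id_hom: "X \<in> Ob C \<Longrightarrow> Id C X \<in> hom C X X"
    and Comp_hom: "\<lbrakk>f \<in> hom C X Y; g \<in> hom C Y Z\<rbrakk> \<Longrightarrow> g \<cdot> f \<in> hom C X Z"
    and Comp_Id: "f \<in> hom C X Y \<Longrightarrow> f \<cdot> Id C X = f"
    and Id_Comp: "f \<in> hom C X Y \<Longrightarrow> Id C Y \<cdot> f = f"
    and Comp_assoc:
      "\<lbrakk>f \<in> hom C W X; g \<in> hom C X Y; h \<in> hom C Y Z\<rbrakk> \<Longrightarrow> (h \<cdot> g) \<cdot> f = h \<cdot> (g \<cdot> f)"

record ('o, 'a, 'p, 'b) cat_map =
  on_Ob :: "'o \<Rightarrow> 'p"
  on_Ar :: "'a \<Rightarrow> 'b"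

locale cat_functor = dom: category A + cod: category B
  for A :: "('o, 'a) cat" and B :: "('p, 'b) cat" and F :: "('o, 'a, 'p, 'b) cat_map" +
  assumes map_Ob: "X \<in> Ob A \<Longrightarrow> on_Ob F X \<in> Ob B"
    and map_hom: "f \<in> hom A X Y \<Longrightarrow> on_Ar F f \<in> hom B (on_Ob F X) (on_Ob F Y)"
    and map_Id: "X \<in> Ob A \<Longrightarrow> on_Ar F (Id A X) = Id B (on_Ob F X)"
    and map_Comp: "\<lbrakk>f \<in> hom A X Y; g \<in> hom A Y Z\<rbrakk> \<Longrightarrow>
      on_Ar F (g \<cdot>\<^bsub>A\<^esub> f) = on_Ar F g \<cdot>\<^bsub>B\<^esub> on_Ar F f"

text \<open>\<open>F : A \<rightarrow> C\<close> is left adjoint to \<open>G : C \<rightarrow> A\<close> with unit \<open>\<eta>\<close>.\<close>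

locale adjunction_with_unit = left: cat_functor A C F + right: cat_functor C A G
  for A :: "('o, 'a) cat" and C :: "('p, 'b) cat"
    and F :: "('o, 'a, 'p, 'b) cat_map" and G :: "('p, 'b, 'o, 'a) cat_map"
    and \<eta> :: "'o \<Rightarrow> 'a" +
  assumes unit_hom: "X \<in> Ob A \<Longrightarrow> \<eta> X \<in> hom A X (on_Ob G (on_Ob F X))"
    and unit_natural: "f \<in> hom A X Y \<Longrightarrow>
      \<eta> Y \<cdot>\<^bsub>A\<^esub> f = on_Ar G (on_Ar F f) \<cdot>\<^bsub>A\<^esub> \<eta> X"
    and unit_bij: "\<lbrakk>X \<in> Ob A; Z \<in> Ob C\<rbrakk> \<Longrightarrow>
      bij_betw (\<lambda>g. on_Ar G g \<cdot>\<^bsub>A\<^esub> \<eta> X) (hom C (on_Ob F X) Z) (hom A X (on_Ob G Z))"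


section \<open>Factorization systems\<close>

definition epic :: "('o, 'a) cat \<Rightarrow> 'a \<Rightarrow> bool" where
  "epic C e \<longleftrightarrow> e \<in> Ar C \<and>
    (\<forall>Z. \<forall>g \<in> hom C (Cod C e) Z. \<forall>h \<in> hom C (Cod C e) Z. g \<cdot>\<^bsub>C\<^esub> e = h \<cdot>\<^bsub>C\<^esub> e \<longrightarrow> g = h)"

definition monic :: "('o, 'a) cat \<Rightarrow> 'a \<Rightarrow> bool" where
  "monic C m \<longleftrightarrow> m \<in> Ar C \<and>
    (\<forall>Z. \<forall>g \<in> hom C Z (Dom C m). \<forall>h \<in> hom C Z (Dom C m). m \<cdot>\<^bsub>C\<^esub> g = m \<cdot>\<^bsub>C\<^esub> h \<longrightarrow> g = h)"

definition iso :: "('o, 'a) cat \<Rightarrow> 'a \<Rightarrow> bool" where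
  "iso C f \<longleftrightarrow> f \<in> Ar C \<and> (\<exists>g \<in> hom C (Cod C f) (Dom C f).
    g \<cdot>\<^bsub>C\<^esub> f = Id C (Dom C f) \<and> f \<cdot>\<^bsub>C\<^esub> g = Id C (Cod C f))"

locale factorization_system = category C
  for C :: "('o, 'a) cat" (structure) and E M :: "'a set" +
  assumes E_Ar: "E \<subseteq> Ar C"
    and M_Ar: "M \<subseteq> Ar C"
    and E_iso: "\<lbrakk>e \<in> E; iso C h; Dom C h = Cod C e\<rbrakk> \<Longrightarrow> h \<cdot> e \<in> E"
    and M_iso: "\<lbrakk>m \<in> M; iso C h; Cod C h = Dom C m\<rbrakk> \<Longrightarrow> m \<cdot> h \<in> M"
    and factorization: "f \<in> Ar C \<Longrightarrow> \<exists>e \<in> E. \<exists>m \<in> M. Cod C e = Dom C m \<and> f = m \<cdot> e"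
    and diagonal: "\<lbrakk>e \<in> E; m \<in> M; f \<in> hom C (Dom C e) (Dom C m); g \<in> hom C (Cod C e) (Cod C m);
        g \<cdot> e = m \<cdot> f\<rbrakk> \<Longrightarrow>
      \<exists>!d. d \<in> hom C (Cod C e) (Dom C m) \<and> d \<cdot> e = f \<and> m \<cdot> d = g"

locale proper_factorization_system = factorization_system C E M
  for C :: "('o, 'a) cat" and E M :: "'a set" +
  assumes E_epic: "e \<in> E \<Longrightarrow> epic C e"
    and M_monic: "m \<in> M \<Longrightarrow> monic C m"


section \<open>Subobjects\<close>

text \<open>
  Subobjects are represented by arrows in \<open>M\<close>, preordered by \<open>sub_le\<close>, instead of by isomorphism
  classes. All relations below are required to be stable under \<open>sub_le\<close> on both sides, so they do
  not distinguish isomorphic subobjects. Likewise, inverse images and intersections are chosen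
  representatives of notions unique up to isomorphism.
\<close>

definition sub :: "('o, 'a) cat \<Rightarrow> 'a set \<Rightarrow> 'o \<Rightarrow> 'a set" where
  "sub C M X = {m \<in> M. Cod C m = X}"

definition sub_le :: "('o, 'a) cat \<Rightarrow> 'a \<Rightarrow> 'a \<Rightarrow> bool" where
  "sub_le C n m \<longleftrightarrow> (\<exists>j \<in> hom C (Dom C n) (Dom C m). m \<cdot>\<^bsub>C\<^esub> j = n)"

text \<open>\<open>p\<close> is the pullback of \<open>n\<close> along \<open>f\<close>, with \<open>q\<close> the other projection.\<close>

definition is_pullback :: "('o, 'a) cat \<Rightarrow> 'a \<Rightarrow> 'a \<Rightarrow> 'a \<Rightarrow> 'a \<Rightarrow> bool" where
  "is_pullback C f n p q \<longleftrightarrow>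
    p \<in> hom C (Dom C p) (Dom C f) \<and> q \<in> hom C (Dom C p) (Dom C n) \<and>
    f \<cdot>\<^bsub>C\<^esub> p = n \<cdot>\<^bsub>C\<^esub> q \<and>
    (\<forall>Z. \<forall>a \<in> hom C Z (Dom C f). \<forall>b \<in> hom C Z (Dom C n). f \<cdot>\<^bsub>C\<^esub> a = n \<cdot>\<^bsub>C\<^esub> b \<longrightarrow>
      (\<exists>!h. h \<in> hom C Z (Dom C p) \<and> p \<cdot>\<^bsub>C\<^esub> h = a \<and> q \<cdot>\<^bsub>C\<^esub> h = b))"

text \<open>
  The intersection of a family \<open>N\<close> of monomorphisms into \<open>X\<close> is its multiple pullback; the
  projections to the members of \<open>N\<close> are uniquely determined and need not be recorded.
  The intersection of the empty family is the top subobject of \<open>X\<close>.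
\<close>

definition is_intersection :: "('o, 'a) cat \<Rightarrow> 'o \<Rightarrow> 'a set \<Rightarrow> 'a \<Rightarrow> bool" where
  "is_intersection C X N p \<longleftrightarrow>
    p \<in> hom C (Dom C p) X \<and> (\<forall>n \<in> N. sub_le C p n) \<and>
    (\<forall>Z. \<forall>f \<in> hom C Z X. (\<forall>n \<in> N. sub_le C f n) \<longrightarrow>
      (\<exists>!h. h \<in> hom C Z (Dom C p) \<and> p \<cdot>\<^bsub>C\<^esub> h = f))"

definition M_complete :: "('o, 'a) cat \<Rightarrow> 'a set \<Rightarrow> bool" where
  "M_complete C M \<longleftrightarrow>
    (\<forall>X Y. \<forall>f \<in> hom C X Y. \<forall>n \<in> sub C M Y.
      (\<exists>p q. is_pullback C f n p q) \<and> (\<forall>p q. is_pullback C f n p q \<longrightarrow> p \<in> M)) \<and>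
    (\<forall>X \<in> Ob C. \<forall>N \<subseteq> sub C M X.
      (\<exists>p. is_intersection C X N p) \<and> (\<forall>p. is_intersection C X N p \<longrightarrow> p \<in> M))"

definition inverse_image :: "('o, 'a) cat \<Rightarrow> 'a \<Rightarrow> 'a \<Rightarrow> 'a" where
  "inverse_image C f n = (SOME p. \<exists>q. is_pullback C f n p q)"

definition intersection :: "('o, 'a) cat \<Rightarrow> 'o \<Rightarrow> 'a set \<Rightarrow> 'a" where
  "intersection C X N = (SOME p. is_intersection C X N p)"

definition preserves_subobjects :: "('o, 'a, 'p, 'b) cat_map \<Rightarrow> 'a set \<Rightarrow> 'b set \<Rightarrow> bool" where
  "preserves_subobjects F M N \<longleftrightarrow> (\<forall>m \<in> M. on_Ar F m \<in> N)"


section \<open>Topogenous orders and syntopogenous structures\<close>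

definition sub_relation :: "('o, 'a) cat \<Rightarrow> 'a set \<Rightarrow> 'o \<Rightarrow> 'a rel \<Rightarrow> bool" where
  "sub_relation C M X R \<longleftrightarrow> R \<subseteq> sub C M X \<times> sub C M X"

definition T1 :: "('o, 'a) cat \<Rightarrow> 'a rel \<Rightarrow> bool" where
  "T1 C R \<longleftrightarrow> (\<forall>m n. (m, n) \<in> R \<longrightarrow> sub_le C m n)"

definition T2 :: "('o, 'a) cat \<Rightarrow> 'a set \<Rightarrow> 'o \<Rightarrow> 'a rel \<Rightarrow> bool" where
  "T2 C M X R \<longleftrightarrow>
    (\<forall>m \<in> sub C M X. \<forall>n \<in> sub C M X. \<forall>p \<in> sub C M X. \<forall>q \<in> sub C M X.
      sub_le C m n \<and> (n, p) \<in> R \<and> sub_le C p q \<longrightarrow> (m, q) \<in> R)"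

definition T3 :: "('o, 'a) cat \<Rightarrow> ('o \<Rightarrow> 'a rel) \<Rightarrow> bool" where
  "T3 C R \<longleftrightarrow> (\<forall>X Y. \<forall>f \<in> hom C X Y. \<forall>m n. (m, n) \<in> R Y \<longrightarrow>
    (inverse_image C f m, inverse_image C f n) \<in> R X)"

definition topogenous_order :: "('o, 'a) cat \<Rightarrow> 'a set \<Rightarrow> ('o \<Rightarrow> 'a rel) \<Rightarrow> bool" where
  "topogenous_order C M R \<longleftrightarrow>
    (\<forall>X \<in> Ob C. sub_relation C M X (R X) \<and> T1 C (R X) \<and> T2 C M X (R X)) \<and> T3 C R"

text \<open>The family \<open>N\<close> may be empty.\<close>

definition meet_preserving :: "('o, 'a) cat \<Rightarrow> 'a set \<Rightarrow> 'o \<Rightarrow> 'a rel \<Rightarrow> bool" where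
  "meet_preserving C M X R \<longleftrightarrow>
    (\<forall>m \<in> sub C M X. \<forall>N \<subseteq> sub C M X. (\<forall>n \<in> N. (m, n) \<in> R) \<longrightarrow> (m, intersection C X N) \<in> R)"

definition interpolative :: "'a rel \<Rightarrow> bool" where
  "interpolative R \<longleftrightarrow> (\<forall>m n. (m, n) \<in> R \<longrightarrow> (\<exists>p. (m, p) \<in> R \<and> (p, n) \<in> R))"

definition directed_family :: "'x set set \<Rightarrow> bool" where
  "directed_family D \<longleftrightarrow> D \<noteq> {} \<and> (\<forall>R \<in> D. \<forall>R' \<in> D. \<exists>R'' \<in> D. R \<subseteq> R'' \<and> R' \<subseteq> R'')"

definition syntopogenous :: "('o, 'a) cat \<Rightarrow> 'a set \<Rightarrow> ('o \<Rightarrow> 'a rel set) \<Rightarrow> bool" where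
  "syntopogenous C M S \<longleftrightarrow>
    (\<forall>X \<in> Ob C. \<forall>R \<in> S X. sub_relation C M X R \<and> T1 C R \<and> T2 C M X R) \<and>
    (\<forall>X \<in> Ob C. directed_family (S X)) \<and>
    topogenous_order C M (\<lambda>X. \<Union>(S X)) \<and>
    (\<forall>X \<in> Ob C. interpolative (\<Union>(S X)))"

definition co_perfect :: "('o, 'a) cat \<Rightarrow> 'a set \<Rightarrow> ('o \<Rightarrow> 'a rel set) \<Rightarrow> bool" where
  "co_perfect C M S \<longleftrightarrow> (\<forall>X \<in> Ob C. \<forall>R \<in> S X. meet_preserving C M X R)"

definition coarser :: "('o, 'a) cat \<Rightarrow> ('o \<Rightarrow> 'a rel set) \<Rightarrow> ('o \<Rightarrow> 'a rel set) \<Rightarrow> bool" where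
  "coarser C S S' \<longleftrightarrow> (\<forall>X \<in> Ob C. \<forall>R \<in> S X. \<exists>R' \<in> S' X. R \<subseteq> R')"

definition U_op :: "('o, 'a) cat \<Rightarrow> 'o \<Rightarrow> 'a rel \<Rightarrow> 'a \<Rightarrow> 'a" where
  "U_op C X R m = intersection C X {n. (m, n) \<in> R}"

definition syn_continuous ::
  "('o, 'a) cat \<Rightarrow> 'a set \<Rightarrow> ('p, 'b) cat \<Rightarrow> ('o, 'a, 'p, 'b) cat_map \<Rightarrow>
    ('o \<Rightarrow> 'a rel set) \<Rightarrow> ('p \<Rightarrow> 'b rel set) \<Rightarrow> bool" where
  "syn_continuous A M' C F T S \<longleftrightarrow>
    (\<forall>X \<in> Ob A. \<forall>R' \<in> S (on_Ob F X). \<exists>R \<in> T X. \<forall>m \<in> sub A M' X.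
      sub_le C (on_Ar F (U_op A X R m)) (U_op C (on_Ob F X) R' (on_Ar F m)))"

definition unit_relation ::
  "('o, 'a) cat \<Rightarrow> 'a set \<Rightarrow> ('p, 'b) cat \<Rightarrow> ('o, 'a, 'p, 'b) cat_map \<Rightarrow>
    ('p, 'b, 'o, 'a) cat_map \<Rightarrow> ('o \<Rightarrow> 'a) \<Rightarrow> 'o \<Rightarrow> 'b rel \<Rightarrow> 'a rel" where
  "unit_relation A M' C F G \<eta> X R =
    {(m, n). m \<in> sub A M' X \<and> n \<in> sub A M' X \<and>
      sub_le A (inverse_image A (\<eta> X) (on_Ar G (U_op C (on_Ob F X) R (on_Ar F m)))) n}"

definition unit_structure ::
  "('o, 'a) cat \<Rightarrow> 'a set \<Rightarrow> ('p, 'b) cat \<Rightarrow> ('o, 'a, 'p, 'b) cat_map \<Rightarrow>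
    ('p, 'b, 'o, 'a) cat_map \<Rightarrow> ('o \<Rightarrow> 'a) \<Rightarrow> ('p \<Rightarrow> 'b rel set) \<Rightarrow> 'o \<Rightarrow> 'a rel set" where
  "unit_structure A M' C F G \<eta> S X = {unit_relation A M' C F G \<eta> X R |R. R \<in> S (on_Ob F X)}"

end

theory Submission
  imports Defs
begin

text \<open>
  On arrows into \<open>X\<close>, ordered by factorization, \<open>V \<mapsto> \<eta>\<^sub>X\<^sup>-\<^sup>1 (G V)\<close> is right adjoint to \<open>F\<close>: both
  \<open>a \<le> \<eta>\<^sub>X\<^sup>-\<^sup>1 (G V)\<close> and \<open>F a \<le> V\<close> say that \<open>\<eta>\<^sub>X \<cdot> a\<close> factors through \<open>G V\<close>. Moreover, a
  \<open>\<And>\<close>-preserving \<open>\<sqsubset>\<close> is recovered from its operator, as \<open>m \<sqsubset> n\<close> iff \<open>U\<^sup>\<sqsubset> m \<le> n\<close>. With these two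
  equivalences, every axiom of \<open>\<S>\<^sup>\<eta>\<close> and its minimality reduce to order-theoretic manipulations.
\<close>

section \<open>The preorder of factorization on arrows with a common codomain\<close>

context category
begin

lemma in_hom: "f \<in> Ar C \<Longrightarrow> f \<in> hom C (Dom C f) (Cod C f)"
  by (simp add: hom_def)

lemma sub_leI: "\<lbrakk>j \<in> hom C Z (Dom C m); m \<in> Ar C\<rbrakk> \<Longrightarrow> sub_le C (m \<cdot> j) m"
  using Comp_hom[of j Z "Dom C m" m "Cod C m"] by (auto simp: sub_le_def hom_def)

lemma sub_leE:
  assumes "sub_le C n m"
  obtains j where "j \<in> hom C (Dom C n) (Dom C m)" "n = m \<cdot> j"
  using assms by (auto simp: sub_le_def)

lemma sub_le_refl: "m \<in> Ar C \<Longrightarrow> sub_le C m m"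
  using sub_leI[of "Id C (Dom C m)" "Dom C m" m] Id_hom Dom_Ob Comp_Id in_hom by metis

lemma sub_le_trans:
  assumes "sub_le C n m" "sub_le C m p" "p \<in> Ar C"
  shows "sub_le C n p"
proof -
  obtain j where j: "j \<in> hom C (Dom C n) (Dom C m)" "n = m \<cdot> j"
    using assms(1) by (rule sub_leE)
  obtain k where k: "k \<in> hom C (Dom C m) (Dom C p)" "m = p \<cdot> k"
    using assms(2) by (rule sub_leE)
  have "n = p \<cdot> (k \<cdot> j)"
    using Comp_assoc[OF j(1) k(1) in_hom[OF assms(3)]] j(2) k(2) by simp
  then show ?thesis
    using sub_leI[OF Comp_hom[OF j(1) k(1)] assms(3)] by simp
qed

lemma sub_le_Comp_left:
  assumes "sub_le C a b" "b \<in> hom C W X" "f \<in> hom C X Y"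
  shows "sub_le C (f \<cdot> a) (f \<cdot> b)"
proof -
  obtain j where j: "j \<in> hom C (Dom C a) (Dom C b)" "a = b \<cdot> j"
    using assms(1) by (rule sub_leE)
  have W: "Dom C b = W"
    using assms(2) by (simp add: hom_def)
  have fb: "f \<cdot> b \<in> hom C W Y"
    using Comp_hom[OF assms(2,3)] .
  have "(f \<cdot> b) \<cdot> j = f \<cdot> a"
    using Comp_assoc[OF j(1)[unfolded W] assms(2,3)] j(2) by simp
  then show ?thesis
    using sub_leI[of j "Dom C a" "f \<cdot> b"] j(1) W fb by (simp add: hom_def)
qed

end

section \<open>Factorization under functors and adjunctions\<close>

lemma (in cat_functor) sub_le_map:
  assumes "sub_le A a b" "b \<in> Ar A"
  shows "sub_le B (on_Ar F a) (on_Ar F b)"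
proof -
  obtain j where j: "j \<in> hom A (Dom A a) (Dom A b)" "a = b \<cdot>\<^bsub>A\<^esub> j"
    using assms(1) by (rule dom.sub_leE)
  have Fb: "on_Ar F b \<in> hom B (on_Ob F (Dom A b)) (on_Ob F (Cod A b))"
    using map_hom[OF dom.in_hom[OF assms(2)]] .
  have "on_Ar F a = on_Ar F b \<cdot>\<^bsub>B\<^esub> on_Ar F j"
    using map_Comp[OF j(1) dom.in_hom[OF assms(2)]] j(2) by simp
  then show ?thesis
    using cod.sub_leI[of "on_Ar F j" "on_Ob F (Dom A a)" "on_Ar F b"] map_hom[OF j(1)] Fb
    by (simp add: hom_def)
qed

text \<open>Naturality turns \<open>\<eta> X \<cdot> a\<close> into
  \<open>G (F a) \<cdot> \<eta> K\<close>, the transpose of \<open>F a\<close>, while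
  \<open>G V \<cdot> (G h \<cdot> \<eta> K)\<close> is the transpose of \<open>V \<cdot> h\<close>.
  Hence factorizations through \<open>G V\<close> in \<open>A\<close> correspond to factorizations
  through \<open>V\<close> in \<open>C\<close>.\<close>

lemma (in adjunction_with_unit) sub_le_transpose_iff:
  assumes a: "a \<in> hom A K X" and V: "V \<in> hom C W (on_Ob F X)"
  shows "sub_le A (\<eta> X \<cdot>\<^bsub>A\<^esub> a) (on_Ar G V) \<longleftrightarrow> sub_le C (on_Ar F a) V"
proof -
  have K: "K \<in> Ob A" and X: "X \<in> Ob A" and W: "W \<in> Ob C"
    using a V left.dom.Dom_Ob left.dom.Cod_Ob left.cod.Dom_Ob by (auto simp: hom_def)
  have Fa: "on_Ar F a \<in> hom C (on_Ob F K) (on_Ob F X)"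
    using a by (rule left.map_hom)
  have GV: "on_Ar G V \<in> hom A (on_Ob G W) (on_Ob G (on_Ob F X))"
    using V by (rule right.map_hom)
  have nat: "\<eta> X \<cdot>\<^bsub>A\<^esub> a = on_Ar G (on_Ar F a) \<cdot>\<^bsub>A\<^esub> \<eta> K"
    using a by (rule unit_natural)
  have \<eta>a: "\<eta> X \<cdot>\<^bsub>A\<^esub> a \<in> hom A K (on_Ob G (on_Ob F X))"
    using left.dom.Comp_hom[OF a unit_hom[OF X]] .
  have trans: "on_Ar G (V \<cdot>\<^bsub>C\<^esub> h) \<cdot>\<^bsub>A\<^esub> \<eta> K = on_Ar G V \<cdot>\<^bsub>A\<^esub> (on_Ar G h \<cdot>\<^bsub>A\<^esub> \<eta> K)"
    if "h \<in> hom C (on_Ob F K) W" for h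
    using right.map_Comp[OF that V]
      left.dom.Comp_assoc[OF unit_hom[OF K] right.map_hom[OF that] GV] by simp
  show ?thesis
  proof
    assume "sub_le A (\<eta> X \<cdot>\<^bsub>A\<^esub> a) (on_Ar G V)"
    then obtain q where q: "q \<in> hom A K (on_Ob G W)" "\<eta> X \<cdot>\<^bsub>A\<^esub> a = on_Ar G V \<cdot>\<^bsub>A\<^esub> q"
      using \<eta>a GV by (auto simp: hom_def elim!: left.dom.sub_leE)
    \<comment> \<open>Surjectivity of transposition at the codomain \<open>W\<close>: the factor
      \<open>q\<close> is the transpose of some \<open>h\<close>.\<close>
    obtain h where h: "h \<in> hom C (on_Ob F K) W" "q = on_Ar G h \<cdot>\<^bsub>A\<^esub> \<eta> K"
      using bij_betw_imp_surj_on[OF unit_bij[OF K W]] q(1) by blast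
    have "on_Ar G (on_Ar F a) \<cdot>\<^bsub>A\<^esub> \<eta> K = on_Ar G (V \<cdot>\<^bsub>C\<^esub> h) \<cdot>\<^bsub>A\<^esub> \<eta> K"
      using nat q(2) h(2) trans[OF h(1)] by simp
    \<comment> \<open>Both arrows go from \<open>F K\<close> to \<open>F X\<close>, and
      transposition is injective there.\<close>
    then have "on_Ar F a = V \<cdot>\<^bsub>C\<^esub> h"
      using bij_betw_imp_inj_on[OF unit_bij[OF K left.map_Ob[OF X]]] Fa
        left.cod.Comp_hom[OF h(1) V] by (auto dest: inj_onD)
    then show "sub_le C (on_Ar F a) V"
      using left.cod.sub_leI[of h _ V] h(1) V by (simp add: hom_def)
  next
    assume "sub_le C (on_Ar F a) V"
    then obtain h where h: "h \<in> hom C (on_Ob F K) W" "on_Ar F a = V \<cdot>\<^bsub>C\<^esub> h"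
      using Fa V by (auto simp: hom_def elim!: left.cod.sub_leE)
    have "\<eta> X \<cdot>\<^bsub>A\<^esub> a = on_Ar G V \<cdot>\<^bsub>A\<^esub> (on_Ar G h \<cdot>\<^bsub>A\<^esub> \<eta> K)"
      using nat h(2) trans[OF h(1)] by simp
    moreover have "on_Ar G h \<cdot>\<^bsub>A\<^esub> \<eta> K \<in> hom A K (on_Ob G W)"
      using left.dom.Comp_hom[OF unit_hom[OF K] right.map_hom[OF h(1)]] .
    ultimately show "sub_le A (\<eta> X \<cdot>\<^bsub>A\<^esub> a) (on_Ar G V)"
      using left.dom.sub_leI[of _ K "on_Ar G V"] GV by (simp add: hom_def)
  qed
qed

section \<open>Inverse images, intersections and operators, developed once for use in both
  categories\<close>

locale M_complete_category = category C
  for C :: "('o, 'a) cat" (structure) and M :: "'a set" +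
  assumes M_Ar: "M \<subseteq> Ar C"
    and complete: "M_complete C M"
begin

lemma sub_hom: "m \<in> sub C M X \<Longrightarrow> m \<in> hom C (Dom C m) X"
  using M_Ar by (auto simp: sub_def hom_def)

lemma sub_Ar: "m \<in> sub C M X \<Longrightarrow> m \<in> Ar C"
  using M_Ar by (auto simp: sub_def)

text \<open>The universal property of the pullback, read in the preorder. The test arrow
  \<open>a\<close> is arbitrary because composites \<open>f \<cdot> k\<close>, which need not belong
  to the class of subobjects, are tested later.\<close>

lemma
  assumes f: "f \<in> hom C X Y" and n: "n \<in> sub C M Y"
  shows inverse_image_sub: "inverse_image C f n \<in> sub C M X"
    and le_inverse_image_iff:
      "a \<in> hom C Z X \<Longrightarrow> sub_le C a (inverse_image C f n) \<longleftrightarrow> sub_le C (f \<cdot> a) n"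
proof -
  have Df: "Dom C f = X"
    using f by (simp add: hom_def)
  have "\<exists>p q. is_pullback C f n p q"
    using complete f n by (auto simp: M_complete_def)
  then have "\<exists>q. is_pullback C f n (inverse_image C f n) q"
    unfolding inverse_image_def by (rule someI_ex)
  then obtain p q where p: "p = inverse_image C f n" and pb: "is_pullback C f n p q"
    by blast
  have pM: "p \<in> M"
    using complete f n pb unfolding M_complete_def by blast
  have ph: "p \<in> hom C (Dom C p) X" and qh: "q \<in> hom C (Dom C p) (Dom C n)"
    and comm: "f \<cdot> p = n \<cdot> q"
    using pb Df by (auto simp: is_pullback_def)
  show "inverse_image C f n \<in> sub C M X"
    using pM ph p by (auto simp: sub_def hom_def)
  assume a: "a \<in> hom C Z X"
  have Da: "Dom C a = Z" and Dfa: "Dom C (f \<cdot> a) = Z"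
    using a Comp_hom[OF a f] by (auto simp: hom_def)
  have "sub_le C a p \<longleftrightarrow> sub_le C (f \<cdot> a) n"
  proof
    assume "sub_le C a p"
    then have "sub_le C (f \<cdot> a) (f \<cdot> p)"
      using ph f by (rule sub_le_Comp_left)
    moreover have "sub_le C (f \<cdot> p) n"
      using sub_leI[OF qh sub_Ar[OF n]] comm by simp
    ultimately show "sub_le C (f \<cdot> a) n"
      using sub_Ar[OF n] by (rule sub_le_trans)
  next
    assume "sub_le C (f \<cdot> a) n"
    then obtain b where "b \<in> hom C Z (Dom C n)" "f \<cdot> a = n \<cdot> b"
      using Dfa by (auto elim: sub_leE)
    then have "\<exists>h. h \<in> hom C Z (Dom C p) \<and> p \<cdot> h = a"
      using pb a Df unfolding is_pullback_def by blast
    then show "sub_le C a p"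
      using Da by (auto simp: sub_le_def)
  qed
  then show "sub_le C a (inverse_image C f n) \<longleftrightarrow> sub_le C (f \<cdot> a) n"
    using p by simp
qed

text \<open>The universal property of the multiple pullback makes the intersection an infimum among
  subobjects; for empty \<open>N\<close> it is the top one.\<close>

lemma
  assumes X: "X \<in> Ob C" and N: "N \<subseteq> sub C M X"
  shows intersection_sub: "intersection C X N \<in> sub C M X"
    and intersection_le: "n \<in> N \<Longrightarrow> sub_le C (intersection C X N) n"
    and le_intersection:
      "\<lbrakk>a \<in> sub C M X; \<And>n. n \<in> N \<Longrightarrow> sub_le C a n\<rbrakk> \<Longrightarrow> sub_le C a (intersection C X N)"
proof -
  have "\<exists>p. is_intersection C X N p"
    using complete X N unfolding M_complete_def by blast
  then have int: "is_intersection C X N (intersection C X N)"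
    unfolding intersection_def by (rule someI_ex)
  then have p: "intersection C X N \<in> hom C (Dom C (intersection C X N)) X"
    and le: "\<forall>n \<in> N. sub_le C (intersection C X N) n"
    and univ: "\<And>Z f. \<lbrakk>f \<in> hom C Z X; \<forall>n \<in> N. sub_le C f n\<rbrakk> \<Longrightarrow>
      \<exists>!h. h \<in> hom C Z (Dom C (intersection C X N)) \<and> intersection C X N \<cdot> h = f"
    unfolding is_intersection_def by blast+
  have "intersection C X N \<in> M"
    using complete X N int unfolding M_complete_def by blast
  then show "intersection C X N \<in> sub C M X"
    using p by (simp add: sub_def hom_def)
  show "n \<in> N \<Longrightarrow> sub_le C (intersection C X N) n"
    using le by blast
  assume "a \<in> sub C M X" and "\<And>n. n \<in> N \<Longrightarrow> sub_le C a n"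
  then have "\<exists>h. h \<in> hom C (Dom C a) (Dom C (intersection C X N)) \<and> intersection C X N \<cdot> h = a"
    using univ[OF sub_hom] by blast
  then show "sub_le C a (intersection C X N)"
    by (auto simp: sub_le_def)
qed

lemma
  assumes X: "X \<in> Ob C" and R: "sub_relation C M X R"
  shows U_op_sub: "U_op C X R m \<in> sub C M X"
    and U_op_le: "(m, n) \<in> R \<Longrightarrow> sub_le C (U_op C X R m) n"
    and le_U_op: "\<lbrakk>T1 C R; m \<in> sub C M X\<rbrakk> \<Longrightarrow> sub_le C m (U_op C X R m)"
proof -
  have N: "{n. (m, n) \<in> R} \<subseteq> sub C M X"
    using R by (auto simp: sub_relation_def)
  show "U_op C X R m \<in> sub C M X"
    unfolding U_op_def by (rule intersection_sub[OF X N])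
  show "(m, n) \<in> R \<Longrightarrow> sub_le C (U_op C X R m) n"
    unfolding U_op_def by (rule intersection_le[OF X N]) simp
  show "\<lbrakk>T1 C R; m \<in> sub C M X\<rbrakk> \<Longrightarrow> sub_le C m (U_op C X R m)"
    unfolding U_op_def by (rule le_intersection[OF X N]) (auto simp: T1_def)
qed

text \<open>Meet preservation is applied to the family of all \<open>n\<close> related to
  \<open>m\<close>. Together with \<open>U_op_le\<close> and (T2) it shows that \<open>R\<close> is
  determined by its operator: for subobjects, \<open>m\<close> is related to \<open>n\<close> iff
  \<open>U_op C X R m\<close> lies below \<open>n\<close>.\<close>

lemma rel_U_op:
  assumes "sub_relation C M X R" "meet_preserving C M X R" "m \<in> sub C M X"
  shows "(m, U_op C X R m) \<in> R"
proof -
  have "{n. (m, n) \<in> R} \<subseteq> sub C M X"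
    using assms(1) by (auto simp: sub_relation_def)
  then show ?thesis
    using assms(2,3) by (simp add: U_op_def meet_preserving_def)
qed

text \<open>The least subobject related to \<open>m\<close> under \<open>R\<close> is still related
  to \<open>m\<close> under \<open>R'\<close>, so it bounds the operator of
  \<open>R'\<close>.\<close>

lemma U_op_antimono:
  assumes X: "X \<in> Ob C" and R: "sub_relation C M X R" and R': "sub_relation C M X R'"
    and meet: "meet_preserving C M X R" and sub: "R \<subseteq> R'" and m: "m \<in> sub C M X"
  shows "sub_le C (U_op C X R' m) (U_op C X R m)"
  using U_op_le[OF X R'] rel_U_op[OF R meet m] sub by blast

text \<open>By (T2), what \<open>n\<close> is related to is also related to the smaller
  \<open>m\<close>; this is applied to the least such subobject.\<close>

lemma U_op_mono:
  assumes X: "X \<in> Ob C" and R: "sub_relation C M X R" "T2 C M X R" "meet_preserving C M X R"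
    and m: "m \<in> sub C M X" and n: "n \<in> sub C M X" and mn: "sub_le C m n"
  shows "sub_le C (U_op C X R m) (U_op C X R n)"
proof (rule U_op_le[OF X R(1)])
  have U: "U_op C X R n \<in> sub C M X"
    using X R(1) by (rule U_op_sub)
  then show "(m, U_op C X R n) \<in> R"
    using R(2) m n mn rel_U_op[OF R(1,3) n] sub_le_refl[OF sub_Ar[OF U]]
    unfolding T2_def by blast
qed

end

section \<open>Subobjects under the adjunction\<close>

locale subobject_adjunction =
  dom: M_complete_category A M' + cod: M_complete_category C M + adjunction_with_unit A C F G \<eta>
  for A :: "('o, 'a) cat" and C :: "('p, 'b) cat"
    and F :: "('o, 'a, 'p, 'b) cat_map" and G :: "('p, 'b, 'o, 'a) cat_map"
    and \<eta> :: "'o \<Rightarrow> 'a" and M' :: "'a set" and M :: "'b set" +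
  assumes F_pres: "preserves_subobjects F M' M"
    and G_pres: "preserves_subobjects G M M'"
begin

lemma F_sub: "m \<in> sub A M' X \<Longrightarrow> on_Ar F m \<in> sub C M (on_Ob F X)"
  using F_pres left.map_hom[OF dom.sub_hom, of m X]
  by (auto simp: preserves_subobjects_def sub_def hom_def)

lemma G_sub: "n \<in> sub C M Y \<Longrightarrow> on_Ar G n \<in> sub A M' (on_Ob G Y)"
  using G_pres right.map_hom[OF cod.sub_hom, of n Y]
  by (auto simp: preserves_subobjects_def sub_def hom_def)

text \<open>The equivalence composes the pullback property along \<open>\<eta> X\<close> with
  \<open>sub_le_transpose_iff\<close>. The last claim is its counit inequality, obtained by taking
  the inverse image itself for \<open>a\<close>.\<close>

lemma
  assumes X: "X \<in> Ob A" and V: "V \<in> sub C M (on_Ob F X)"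
  shows unit_inverse_image_sub: "inverse_image A (\<eta> X) (on_Ar G V) \<in> sub A M' X"
    and le_unit_inverse_image_iff: "a \<in> hom A K X \<Longrightarrow>
      sub_le A a (inverse_image A (\<eta> X) (on_Ar G V)) \<longleftrightarrow> sub_le C (on_Ar F a) V"
    and F_unit_inverse_image_le: "sub_le C (on_Ar F (inverse_image A (\<eta> X) (on_Ar G V))) V"
proof -
  show sub: "inverse_image A (\<eta> X) (on_Ar G V) \<in> sub A M' X"
    using unit_hom[OF X] G_sub[OF V] by (rule dom.inverse_image_sub)
  show iff: "sub_le A a (inverse_image A (\<eta> X) (on_Ar G V)) \<longleftrightarrow> sub_le C (on_Ar F a) V"
    if "a \<in> hom A K X" for a K
    using dom.le_inverse_image_iff[OF unit_hom[OF X] G_sub[OF V] that]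
      sub_le_transpose_iff[OF that cod.sub_hom[OF V]] by simp
  show "sub_le C (on_Ar F (inverse_image A (\<eta> X) (on_Ar G V))) V"
    using iff[OF dom.sub_hom[OF sub]] dom.sub_le_refl[OF dom.sub_Ar[OF sub]] by simp
qed

lemma unit_inverse_image_mono:
  assumes X: "X \<in> Ob A" and V: "V \<in> sub C M (on_Ob F X)" and W: "W \<in> sub C M (on_Ob F X)"
    and le: "sub_le C V W"
  shows "sub_le A (inverse_image A (\<eta> X) (on_Ar G V)) (inverse_image A (\<eta> X) (on_Ar G W))"
  unfolding le_unit_inverse_image_iff[OF X W dom.sub_hom[OF unit_inverse_image_sub[OF X V]]]
  using F_unit_inverse_image_le[OF X V] le cod.sub_Ar[OF W] by (rule cod.sub_le_trans)

text \<open>For the left-hand side \<open>k\<close>, the counit inequality gives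
  \<open>F k \<le> (F f)^-1 V\<close>, hence
  \<open>F (f \<cdot> k) = F f \<cdot> F k \<le> V\<close>. Transposing over \<open>Y\<close> and
  then pulling back along \<open>f\<close> yields the bound on \<open>k\<close>. This is the
  inequality that (T3) requires.\<close>

lemma inverse_image_unit_le:
  assumes f: "f \<in> hom A X Y" and V: "V \<in> sub C M (on_Ob F Y)"
  shows "sub_le A (inverse_image A (\<eta> X) (on_Ar G (inverse_image C (on_Ar F f) V)))
    (inverse_image A f (inverse_image A (\<eta> Y) (on_Ar G V)))"
    (is "sub_le A ?k _")
proof -
  have X: "X \<in> Ob A" and Y: "Y \<in> Ob A"
    using f dom.Dom_Ob dom.Cod_Ob by (auto simp: hom_def)
  have Ff: "on_Ar F f \<in> hom C (on_Ob F X) (on_Ob F Y)"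
    using f by (rule left.map_hom)
  have W: "inverse_image C (on_Ar F f) V \<in> sub C M (on_Ob F X)"
    using Ff V by (rule cod.inverse_image_sub)
  have k: "?k \<in> hom A (Dom A ?k) X"
    using dom.sub_hom[OF unit_inverse_image_sub[OF X W]] .
  have "sub_le C (on_Ar F f \<cdot>\<^bsub>C\<^esub> on_Ar F ?k) V"
    using F_unit_inverse_image_le[OF X W] cod.le_inverse_image_iff[OF Ff V left.map_hom[OF k]]
    by simp
  then have "sub_le C (on_Ar F (f \<cdot>\<^bsub>A\<^esub> ?k)) V"
    using left.map_Comp[OF k f] by simp
  then have "sub_le A (f \<cdot>\<^bsub>A\<^esub> ?k) (inverse_image A (\<eta> Y) (on_Ar G V))"
    using le_unit_inverse_image_iff[OF Y V dom.Comp_hom[OF k f]] by simp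
  then show ?thesis
    using dom.le_inverse_image_iff[OF f unit_inverse_image_sub[OF Y V] k] by simp
qed

text \<open>Applying \<open>F\<close> to \<open>f \<cdot> f^-1 m \<le> m\<close> gives a
  factorization through \<open>F m\<close>, to which the pullback of \<open>F m\<close> along
  \<open>F f\<close> applies.\<close>

lemma F_inverse_image_le:
  assumes f: "f \<in> hom A X Y" and m: "m \<in> sub A M' Y"
  shows "sub_le C (on_Ar F (inverse_image A f m)) (inverse_image C (on_Ar F f) (on_Ar F m))"
proof -
  have i: "inverse_image A f m \<in> hom A (Dom A (inverse_image A f m)) X"
    using dom.sub_hom[OF dom.inverse_image_sub[OF f m]] .
  have "sub_le A (f \<cdot>\<^bsub>A\<^esub> inverse_image A f m) m"
    using dom.le_inverse_image_iff[OF f m i]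
      dom.sub_le_refl[OF dom.sub_Ar[OF dom.inverse_image_sub[OF f m]]] by simp
  then have "sub_le C (on_Ar F f \<cdot>\<^bsub>C\<^esub> on_Ar F (inverse_image A f m)) (on_Ar F m)"
    using left.sub_le_map[OF _ dom.sub_Ar[OF m]] left.map_Comp[OF i f] by fastforce
  then show ?thesis
    using cod.le_inverse_image_iff[OF left.map_hom[OF f] F_sub[OF m] left.map_hom[OF i]] by simp
qed

end

section \<open>The relations induced by the unit\<close>

locale co_perfect_adjunction = subobject_adjunction A C F G \<eta> M' M
  for A :: "('o, 'a) cat" and C :: "('p, 'b) cat"
    and F :: "('o, 'a, 'p, 'b) cat_map" and G :: "('p, 'b, 'o, 'a) cat_map"
    and \<eta> :: "'o \<Rightarrow> 'a" and M' :: "'a set" and M :: "'b set" +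
  fixes S :: "'p \<Rightarrow> 'b rel set"
  assumes syn: "syntopogenous C M S"
    and perf: "co_perfect C M S"
begin

abbreviation U :: "'o \<Rightarrow> 'b rel \<Rightarrow> 'a \<Rightarrow> 'b" where
  "U X R m \<equiv> U_op C (on_Ob F X) R (on_Ar F m)"

text \<open>For \<open>R\<close> in the structure and \<open>m\<close> a subobject of
  \<open>X\<close>, this is, up to isomorphism, the operator of \<open>unit_rel X R\<close> at
  \<open>m\<close>. It is extensive and monotone; idempotence is not claimed, and interpolation
  takes its place.\<close>

abbreviation closure :: "'o \<Rightarrow> 'b rel \<Rightarrow> 'a \<Rightarrow> 'a" where
  "closure X R m \<equiv> inverse_image A (\<eta> X) (on_Ar G (U X R m))"

abbreviation unit_rel :: "'o \<Rightarrow> 'b rel \<Rightarrow> 'a rel" where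
  "unit_rel \<equiv> unit_relation A M' C F G \<eta>"

abbreviation unit_struct :: "'o \<Rightarrow> 'a rel set" where
  "unit_struct \<equiv> unit_structure A M' C F G \<eta> S"

lemma unit_rel_iff:
  "(m, n) \<in> unit_rel X R \<longleftrightarrow>
    m \<in> sub A M' X \<and> n \<in> sub A M' X \<and> sub_le A (closure X R m) n"
  by (simp add: unit_relation_def)

lemma S_D:
  assumes "Y \<in> Ob C" "R \<in> S Y"
  shows "sub_relation C M Y R" "T1 C R" "T2 C M Y R" "meet_preserving C M Y R"
  using assms syn perf by (auto simp: syntopogenous_def co_perfect_def)

context
  fixes X R
  assumes X: "X \<in> Ob A" and R: "R \<in> S (on_Ob F X)"
begin

lemmas RD = S_D[OF left.map_Ob[OF X] R]

lemma U_sub: "U X R m \<in> sub C M (on_Ob F X)"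
  using left.map_Ob[OF X] RD(1) by (rule cod.U_op_sub)

lemma closure_sub: "closure X R m \<in> sub A M' X"
  using X U_sub by (rule unit_inverse_image_sub)

lemma rel_U: "m \<in> sub A M' X \<Longrightarrow> (on_Ar F m, U X R m) \<in> R"
  using cod.rel_U_op[OF RD(1,4) F_sub] .

text \<open>Transposed, this says that \<open>F m\<close> lies below \<open>U X R m\<close>, which
  is (T1) for \<open>R\<close>.\<close>

lemma le_closure:
  assumes m: "m \<in> sub A M' X"
  shows "sub_le A m (closure X R m)"
  using le_unit_inverse_image_iff[OF X U_sub dom.sub_hom[OF m]]
    cod.le_U_op[OF left.map_Ob[OF X] RD(1,2) F_sub[OF m]] by simp

text \<open>The closure is a composite of three monotone maps: \<open>F\<close>, the operator of
  \<open>R\<close>, and the unit inverse image after \<open>G\<close>.\<close>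

lemma closure_mono:
  assumes m: "m \<in> sub A M' X" and n: "n \<in> sub A M' X" and mn: "sub_le A m n"
  shows "sub_le A (closure X R m) (closure X R n)"
  using X U_sub U_sub
    cod.U_op_mono[OF left.map_Ob[OF X] RD(1,3,4) F_sub[OF m] F_sub[OF n]
      left.sub_le_map[OF mn dom.sub_Ar[OF n]]]
  by (rule unit_inverse_image_mono)

lemma rel_closure: "m \<in> sub A M' X \<Longrightarrow> (m, closure X R m) \<in> unit_rel X R"
  using closure_sub dom.sub_le_refl[OF dom.sub_Ar[OF closure_sub]] by (simp add: unit_rel_iff)

lemma unit_rel_sub_relation: "sub_relation A M' X (unit_rel X R)"
  by (auto simp: sub_relation_def unit_rel_iff)

lemma unit_rel_T1: "T1 A (unit_rel X R)"
  unfolding T1_def unit_rel_iff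
  by (auto intro: dom.sub_le_trans[OF le_closure] dom.sub_Ar)

lemma unit_rel_T2: "T2 A M' X (unit_rel X R)"
  unfolding T2_def
proof (intro ballI impI, elim conjE)
  fix m n p q
  assume m: "m \<in> sub A M' X" and n: "n \<in> sub A M' X" and p: "p \<in> sub A M' X"
    and q: "q \<in> sub A M' X"
    and mn: "sub_le A m n" and "(n, p) \<in> unit_rel X R" and pq: "sub_le A p q"
  then have "sub_le A (closure X R n) p"
    by (simp add: unit_rel_iff)
  then have "sub_le A (closure X R m) p"
    using closure_mono[OF m n mn] dom.sub_Ar[OF p] by (metis dom.sub_le_trans)
  then have "sub_le A (closure X R m) q"
    using pq dom.sub_Ar[OF q] by (rule dom.sub_le_trans)
  then show "(m, q) \<in> unit_rel X R"
    using m q by (simp add: unit_rel_iff)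
qed

text \<open>Being related to \<open>m\<close> means lying above the fixed subobject
  \<open>closure X R m\<close>, and this condition is inherited by infima.\<close>

lemma unit_rel_meet_preserving: "meet_preserving A M' X (unit_rel X R)"
  unfolding meet_preserving_def unit_rel_iff
  by (simp add: dom.intersection_sub[OF X] dom.le_intersection[OF X _ closure_sub])

text \<open>Two reversals cancel: enlarging the relation shrinks its operator and hence the closure,
  and a smaller closure lies below more subobjects.\<close>

lemma unit_rel_mono:
  assumes R': "R' \<in> S (on_Ob F X)" and sub: "R \<subseteq> R'"
  shows "unit_rel X R \<subseteq> unit_rel X R'"
proof safe
  fix m n
  assume mn: "(m, n) \<in> unit_rel X R"
  have R'rel: "sub_relation C M (on_Ob F X) R'"
    using S_D(1)[OF left.map_Ob[OF X] R'] .
  have "sub_le A (closure X R' m) (closure X R m)"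
    using X cod.U_op_sub[OF left.map_Ob[OF X] R'rel] U_sub
  proof (rule unit_inverse_image_mono)
    show "sub_le C (U X R' m) (U X R m)"
      using mn cod.U_op_antimono[OF left.map_Ob[OF X] RD(1) R'rel RD(4) sub] F_sub
      by (simp add: unit_rel_iff)
  qed
  then have "sub_le A (closure X R' m) n"
    using mn unfolding unit_rel_iff by (blast intro: dom.sub_le_trans dom.sub_Ar)
  then show "(m, n) \<in> unit_rel X R'"
    using mn by (simp add: unit_rel_iff)
qed

end

section \<open>The axioms of a co-perfect syntopogenous structure\<close>

lemma unit_struct_directed:
  assumes X: "X \<in> Ob A"
  shows "directed_family (unit_struct X)"
  unfolding directed_family_def
proof (intro conjI ballI)
  have dir: "directed_family (S (on_Ob F X))"
    using syn left.map_Ob[OF X] by (simp add: syntopogenous_def)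
  then show "unit_struct X \<noteq> {}"
    by (auto simp: directed_family_def unit_structure_def)
  fix Q1 Q2
  assume "Q1 \<in> unit_struct X" "Q2 \<in> unit_struct X"
  then obtain R1 R2 where R1: "R1 \<in> S (on_Ob F X)" "Q1 = unit_rel X R1"
    and R2: "R2 \<in> S (on_Ob F X)" "Q2 = unit_rel X R2"
    by (auto simp: unit_structure_def)
  obtain R where R: "R \<in> S (on_Ob F X)" "R1 \<subseteq> R" "R2 \<subseteq> R"
    using dir R1(1) R2(1) unfolding directed_family_def by blast
  then have "Q1 \<subseteq> unit_rel X R" "Q2 \<subseteq> unit_rel X R"
    using unit_rel_mono[OF X] R1 R2 by simp_all
  then show "\<exists>Q\<in>unit_struct X. Q1 \<subseteq> Q \<and> Q2 \<subseteq> Q"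
    using R(1) by (auto simp: unit_structure_def)
qed

text \<open>With \<open>R'\<close> supplied by (T3) for \<open>S\<close> along \<open>F f\<close>,
  the chain is \<open>closure X R' (f^-1 m) \<le> \<eta>^-1 (G ((F f)^-1 (U Y R m))) \<le> f^-1
  (closure Y R m) \<le> f^-1 n\<close>.\<close>

lemma unit_struct_T3: "T3 A (\<lambda>X. \<Union> (unit_struct X))"
  unfolding T3_def
proof (intro allI ballI impI)
  fix X Y f m n
  assume f: "f \<in> hom A X Y" and "(m, n) \<in> \<Union> (unit_struct Y)"
  then obtain R where R: "R \<in> S (on_Ob F Y)" and mn: "(m, n) \<in> unit_rel Y R"
    by (auto simp: unit_structure_def)
  have X: "X \<in> Ob A" and Y: "Y \<in> Ob A"
    using f dom.Dom_Ob dom.Cod_Ob by (auto simp: hom_def)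
  have m: "m \<in> sub A M' Y" and n: "n \<in> sub A M' Y" and le: "sub_le A (closure Y R m) n"
    using mn by (auto simp: unit_rel_iff)
  let ?Ff = "on_Ar F f"
  let ?V = "inverse_image C ?Ff (U Y R m)"
  let ?k = "inverse_image A f m"
  have Ff: "?Ff \<in> hom C (on_Ob F X) (on_Ob F Y)"
    using f by (rule left.map_hom)
  have V: "?V \<in> sub C M (on_Ob F X)"
    using Ff U_sub[OF Y R] by (rule cod.inverse_image_sub)
  have k: "?k \<in> sub A M' X"
    using f m by (rule dom.inverse_image_sub)
  have fn: "inverse_image A f n \<in> sub A M' X"
    using f n by (rule dom.inverse_image_sub)
  have cl: "closure Y R m \<in> sub A M' Y"
    using closure_sub[OF Y R] .
  have "T3 C (\<lambda>X. \<Union> (S X))"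
    using syn by (simp add: syntopogenous_def topogenous_order_def)
  \<comment> \<open>The pair pulled back ends in \<open>U Y R m\<close>, not in \<open>F n\<close>:
    the hypothesis bounds only the closure of \<open>m\<close>, and \<open>(F m, F n)\<close> need
    not belong to \<open>R\<close>.\<close>
  moreover have "(on_Ar F m, U Y R m) \<in> \<Union> (S (on_Ob F Y))"
    using R rel_U[OF Y R m] by blast
  ultimately obtain R' where R': "R' \<in> S (on_Ob F X)"
    and "(inverse_image C ?Ff (on_Ar F m), ?V) \<in> R'"
    using Ff unfolding T3_def by blast
  \<comment> \<open>(T2) on the left: \<open>F (f^-1 m)\<close> lies below
    \<open>(F f)^-1 (F m)\<close>.\<close>
  then have "(on_Ar F ?k, ?V) \<in> R'"
    using S_D(3)[OF left.map_Ob[OF X] R'] F_inverse_image_le[OF f m] F_sub[OF k] V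
      cod.inverse_image_sub[OF Ff F_sub[OF m]] cod.sub_le_refl[OF cod.sub_Ar[OF V]]
    unfolding T2_def by blast
  then have "sub_le C (U X R' ?k) ?V"
    by (rule cod.U_op_le[OF left.map_Ob[OF X] S_D(1)[OF left.map_Ob[OF X] R']])
  then have "sub_le A (closure X R' ?k) (inverse_image A (\<eta> X) (on_Ar G ?V))"
    by (rule unit_inverse_image_mono[OF X U_sub[OF X R'] V])
  then have "sub_le A (closure X R' ?k) (inverse_image A f (closure Y R m))"
    using inverse_image_unit_le[OF f U_sub[OF Y R]]
      dom.sub_Ar[OF dom.inverse_image_sub[OF f cl]] by (rule dom.sub_le_trans)
  moreover have "sub_le A (inverse_image A f (closure Y R m)) (inverse_image A f n)"
  proof -
    have i: "inverse_image A f (closure Y R m) \<in> sub A M' X"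
      using f cl by (rule dom.inverse_image_sub)
    have "sub_le A (f \<cdot>\<^bsub>A\<^esub> inverse_image A f (closure Y R m)) (closure Y R m)"
      using dom.le_inverse_image_iff[OF f cl dom.sub_hom[OF i]]
        dom.sub_le_refl[OF dom.sub_Ar[OF i]] by simp
    then have "sub_le A (f \<cdot>\<^bsub>A\<^esub> inverse_image A f (closure Y R m)) n"
      using le dom.sub_Ar[OF n] by (rule dom.sub_le_trans)
    then show ?thesis
      using dom.le_inverse_image_iff[OF f n dom.sub_hom[OF i]] by simp
  qed
  ultimately have "sub_le A (closure X R' ?k) (inverse_image A f n)"
    using dom.sub_Ar[OF fn] by (rule dom.sub_le_trans)
  then have "(?k, inverse_image A f n) \<in> unit_rel X R'"
    using k fn by (simp add: unit_rel_iff)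
  then show "(?k, inverse_image A f n) \<in> \<Union> (unit_struct X)"
    using R' by (auto simp: unit_structure_def)
qed

text \<open>Interpolation in \<open>S\<close> is applied between \<open>F m\<close> and
  \<open>U X R m\<close>, giving \<open>p\<close> with \<open>F m\<close> related to
  \<open>p\<close> by \<open>R1\<close> and \<open>p\<close> to \<open>U X R m\<close> by
  \<open>R2\<close>; the result is carried back to \<open>X\<close>.\<close>

lemma unit_struct_interpolative:
  assumes X: "X \<in> Ob A"
  shows "interpolative (\<Union> (unit_struct X))"
  unfolding interpolative_def
proof (intro allI impI)
  fix m n
  assume "(m, n) \<in> \<Union> (unit_struct X)"
  then obtain R where R: "R \<in> S (on_Ob F X)" and mn: "(m, n) \<in> unit_rel X R"
    by (auto simp: unit_structure_def)
  have m: "m \<in> sub A M' X" and n: "n \<in> sub A M' X" and le: "sub_le A (closure X R m) n"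
    using mn by (auto simp: unit_rel_iff)
  have FX: "on_Ob F X \<in> Ob C"
    using X by (rule left.map_Ob)
  have "interpolative (\<Union> (S (on_Ob F X)))"
    using syn FX by (simp add: syntopogenous_def)
  moreover have "(on_Ar F m, U X R m) \<in> \<Union> (S (on_Ob F X))"
    using R rel_U[OF X R m] by blast
  ultimately obtain p R1 R2 where R1: "R1 \<in> S (on_Ob F X)" "(on_Ar F m, p) \<in> R1"
    and R2: "R2 \<in> S (on_Ob F X)" "(p, U X R m) \<in> R2"
    unfolding interpolative_def by blast
  \<comment> \<open>Since \<open>p\<close> is a subobject of \<open>F X\<close>, it cannot serve as
    interpolant itself. Its replacement \<open>?k\<close> satisfies
    \<open>F ?k \<le> U X R1 m \<le> p\<close>, so (T2) lets \<open>F ?k\<close> stand for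
    \<open>p\<close> on the left of \<open>R2\<close>.\<close>
  let ?k = "closure X R1 m"
  have k: "?k \<in> sub A M' X"
    using X R1(1) by (rule closure_sub)
  have p: "p \<in> sub C M (on_Ob F X)"
    using S_D(1)[OF FX R1(1)] R1(2) by (auto simp: sub_relation_def)
  have "sub_le C (U X R1 m) p"
    using cod.U_op_le[OF FX S_D(1)[OF FX R1(1)] R1(2)] .
  then have "sub_le C (on_Ar F ?k) p"
    using F_unit_inverse_image_le[OF X U_sub[OF X R1(1)]] cod.sub_Ar[OF p]
    by (blast intro: cod.sub_le_trans)
  then have "(on_Ar F ?k, U X R m) \<in> R2"
    using S_D(3)[OF FX R2(1)] R2(2) F_sub[OF k] p U_sub[OF X R]
      cod.sub_le_refl[OF cod.sub_Ar[OF U_sub[OF X R]]]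
    unfolding T2_def by blast
  then have "sub_le C (U X R2 ?k) (U X R m)"
    by (rule cod.U_op_le[OF FX S_D(1)[OF FX R2(1)]])
  then have "sub_le A (closure X R2 ?k) (closure X R m)"
    by (rule unit_inverse_image_mono[OF X U_sub[OF X R2(1)] U_sub[OF X R]])
  then have "sub_le A (closure X R2 ?k) n"
    using le dom.sub_Ar[OF n] by (rule dom.sub_le_trans)
  then have "(?k, n) \<in> unit_rel X R2"
    using k n by (simp add: unit_rel_iff)
  moreover have "(m, ?k) \<in> unit_rel X R1"
    using X R1(1) m by (rule rel_closure)
  ultimately show "\<exists>p. (m, p) \<in> \<Union> (unit_struct X) \<and> (p, n) \<in> \<Union> (unit_struct X)"
    using R1(1) R2(1) by (auto simp: unit_structure_def)
qed

lemma unit_struct_syntopogenous: "syntopogenous A M' unit_struct"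
proof -
  have rel: "sub_relation A M' X R \<and> T1 A R \<and> T2 A M' X R"
    if "X \<in> Ob A" "R \<in> unit_struct X" for X R
    using that unit_rel_sub_relation unit_rel_T1 unit_rel_T2 by (auto simp: unit_structure_def)
  \<comment> \<open>Each of these conditions concerns one related pair at a time, so it passes to
    unions.\<close>
  have "sub_relation A M' X (\<Union> (unit_struct X)) \<and> T1 A (\<Union> (unit_struct X))
      \<and> T2 A M' X (\<Union> (unit_struct X))" if "X \<in> Ob A" for X
    using rel[OF that] unfolding sub_relation_def T1_def T2_def by blast
  then show ?thesis
    using rel unit_struct_directed unit_struct_T3 unit_struct_interpolative
    by (simp add: syntopogenous_def topogenous_order_def)
qed

lemma unit_struct_co_perfect: "co_perfect A M' unit_struct"
  using unit_rel_meet_preserving by (auto simp: co_perfect_def unit_structure_def)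

section \<open>Continuity and minimality\<close>

lemma unit_struct_continuous: "syn_continuous A M' C F unit_struct S"
  unfolding syn_continuous_def
proof (intro ballI)
  fix X R
  assume X: "X \<in> Ob A" and R: "R \<in> S (on_Ob F X)"
  have "sub_le C (on_Ar F (U_op A X (unit_rel X R) m)) (U X R m)" if m: "m \<in> sub A M' X" for m
  proof -
    \<comment> \<open>The closure of \<open>m\<close> is among the subobjects that the operator
      intersects; the transpose of this bound is the continuity inequality.\<close>
    have "sub_le A (U_op A X (unit_rel X R) m) (closure X R m)"
      using dom.U_op_le[OF X unit_rel_sub_relation[OF X R] rel_closure[OF X R m]] .
    then show ?thesis
      using le_unit_inverse_image_iff[OF X U_sub[OF X R]
          dom.sub_hom[OF dom.U_op_sub[OF X unit_rel_sub_relation[OF X R]]]] by simp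
  qed
  then show "\<exists>R'\<in>unit_struct X. \<forall>m\<in>sub A M' X. sub_le C (on_Ar F (U_op A X R' m)) (U X R m)"
    using R by (auto simp: unit_structure_def)
qed

text \<open>Continuity of \<open>F\<close> for \<open>T\<close> transposes to
  \<open>U_op A X R' m \<le> closure X R m\<close>. Anything above the closure is thus above the
  operator of \<open>R'\<close>, and since \<open>R'\<close> preserves meets, it is related to
  \<open>m\<close> by \<open>R'\<close>.\<close>

lemma unit_struct_coarsest:
  assumes T: "syntopogenous A M' T" "co_perfect A M' T" "syn_continuous A M' C F T S"
  shows "coarser A unit_struct T"
  unfolding coarser_def
proof (intro ballI)
  fix X Q
  assume X: "X \<in> Ob A" and "Q \<in> unit_struct X"
  then obtain R where R: "R \<in> S (on_Ob F X)" and Q: "Q = unit_rel X R"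
    by (auto simp: unit_structure_def)
  then obtain R' where R': "R' \<in> T X"
    and cont: "\<And>m. m \<in> sub A M' X \<Longrightarrow> sub_le C (on_Ar F (U_op A X R' m)) (U X R m)"
    using T(3) X unfolding syn_continuous_def by blast
  have R'D: "sub_relation A M' X R'" "T2 A M' X R'" "meet_preserving A M' X R'"
    using T(1,2) X R' by (auto simp: syntopogenous_def co_perfect_def)
  have "Q \<subseteq> R'"
  proof safe
    fix m n
    assume "(m, n) \<in> Q"
    then have m: "m \<in> sub A M' X" and n: "n \<in> sub A M' X" and le: "sub_le A (closure X R m) n"
      by (auto simp: Q unit_rel_iff)
    have U': "U_op A X R' m \<in> sub A M' X"
      using X R'D(1) by (rule dom.U_op_sub)
    have "sub_le A (U_op A X R' m) (closure X R m)"
      using le_unit_inverse_image_iff[OF X U_sub[OF X R] dom.sub_hom[OF U']] cont[OF m] by simp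
    then have "sub_le A (U_op A X R' m) n"
      using le dom.sub_Ar[OF n] by (rule dom.sub_le_trans)
    then show "(m, n) \<in> R'"
      using R'D(2) dom.rel_U_op[OF R'D(1,3) m] m n U' dom.sub_le_refl[OF dom.sub_Ar[OF m]]
      unfolding T2_def by blast
  qed
  then show "\<exists>R'\<in>T X. Q \<subseteq> R'"
    using R' by blast
qed

end

text \<open>The comparison ranges over co-perfect \<open>T\<close> because continuity speaks of
  operators, from which meet-preserving relations can be recovered.\<close>

theorem proposition13:
  fixes A :: "('o, 'a) cat" and E' M' :: "'a set"
    and C :: "('p, 'b) cat" and E M :: "'b set"
    and F :: "('o, 'a, 'p, 'b) cat_map" and G :: "('p, 'b, 'o, 'a) cat_map"
    and \<eta> :: "'o \<Rightarrow> 'a" and S :: "'p \<Rightarrow> 'b rel set" and S\<eta> :: "'o \<Rightarrow> 'a rel set"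
  assumes "proper_factorization_system C E M" and "M_complete C M"
    and "factorization_system A E' M'" and "\<forall>m \<in> M'. monic A m" and "M_complete A M'"
    and "adjunction_with_unit A C F G \<eta>"
    and "preserves_subobjects F M' M" and "preserves_subobjects G M M'"
    and "syntopogenous C M S" and "co_perfect C M S"
    and "S\<eta> = unit_structure A M' C F G \<eta> S"
  shows "syntopogenous A M' S\<eta> \<and> co_perfect A M' S\<eta>
    \<and> syn_continuous A M' C F S\<eta> S
    \<and> (\<forall>T. syntopogenous A M' T \<and> co_perfect A M' T \<and> syn_continuous A M' C F T S
          \<longrightarrow> coarser A S\<eta> T)"
proof -
  have "M_complete_category A M'"
    using assms(3,5)
    by (simp add: M_complete_category_def M_complete_category_axioms_def
        factorization_system_def factorization_system_axioms_def)
  moreover have "M_complete_category C M"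
    using assms(1,2)
    by (simp add: M_complete_category_def M_complete_category_axioms_def
        proper_factorization_system_def factorization_system_def factorization_system_axioms_def)
  ultimately interpret co_perfect_adjunction A C F G \<eta> M' M S
    using assms(6-10)
    by (simp add: co_perfect_adjunction_def co_perfect_adjunction_axioms_def
        subobject_adjunction_def subobject_adjunction_axioms_def)
  show ?thesis
    using assms(11) unit_struct_syntopogenous unit_struct_co_perfect unit_struct_continuous
      unit_struct_coarsest by blast
qed

end
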